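(* Let $\mathfrak{g}$ be a finite-dimensional complex Lie algebra and $\phi:\mathfrak{g}^*\times\mathfrak{g}^*\to\mathfrak{g}$ a symmetric bilinear map such that, for all $X\in\mathfrak{g}$ and $f,g,h\in\mathfrak{g}^*$: (1) $\mathrm{ad}(X)(\phi(f,g))+\phi(f,g\circ\mathrm{ad}(X))+\phi(g,f\circ\mathrm{ad}(X))=0$; (2) $f\circ\mathrm{ad}(\phi(g,h))+g\circ\mathrm{ad}(\phi(h,f))+h\circ\mathrm{ad}(\phi(f,g))=0$. Then the vector space $\overline{\mathfrak{g}}=\mathfrak{g}\oplus\mathfrak{g}^*$, with even part $\mathfrak{g}$, odd part $\mathfrak{g}^*$ and the bracket $$[X+f,Y+g]=[X,Y]+\mathrm{ad}^*(X)(g)-\mathrm{ad}^*(Y)(f)+\phi(f,g),\quad X,Y\in\mathfrak{g},\ f,g\in\mathfrak{g}^*,$$ is a Lie superalgebra. Moreover, if $\phi$ satisfies the cyclic condition $h(\phi(f,g))=f(\phi(g,h))$ for all $f,g,h\in\mathfrak{g}^*$, then $\overline{\mathfrak{g}}$ is an odd quadratic Lie superalgebra with the bilinear form $$\overline{B}(X+f,Y+g)=f(Y)+g(X),\quad X,Y\in\mathfrak{g},\ f,g\in\mathfrak{g}^*.$$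
   Context: All vector spaces are finite-dimensional over $\mathbb{C}$. The coadjoint representation is $\mathrm{ad}^*(X)(f)=-f\circ\mathrm{ad}(X)$. An odd quadratic Lie superalgebra is a Lie superalgebra $\mathfrak{g}=\mathfrak{g}_{\overline 0}\oplus\mathfrak{g}_{\overline 1}$ with a non-degenerate bilinear form $B$ that is supersymmetric ($B(Y,X)=(-1)^{xy}B(X,Y)$ for $X\in\mathfrak{g}_x$, $Y\in\mathfrak{g}_y$), invariant ($B([X,Y],Z)=B(X,[Y,Z])$), and odd ($B(\mathfrak{g}_\alpha,\mathfrak{g}_\alpha)=0$ for $\alpha\in\mathbb{Z}_2$). *)

theory Defs
  imports "HOL-Analysis.Product_Vector" "HOL-Library.Function_Algebras" "HOL-Library.Z2"
begin

text \<open>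
  Complex vector spaces are given by an explicit scalar multiplication in the sense of
  \<^locale>\<open>vector_space\<close>. The Lie algebra fills its whole type, whereas the dual space and the
  superalgebra built from it are subspaces of ambient types. Conditions on maps are therefore
  relativised to a carrier set: their values outside the carrier play no role.
\<close>

definition bilinear_on ::
  "'a set \<Rightarrow> (complex \<Rightarrow> 'a \<Rightarrow> 'a) \<Rightarrow> (complex \<Rightarrow> 'b \<Rightarrow> 'b)
    \<Rightarrow> ('a::ab_group_add \<Rightarrow> 'a \<Rightarrow> 'b::ab_group_add) \<Rightarrow> bool"
  where "bilinear_on A s t b \<longleftrightarrow>
    (\<forall>x\<in>A. \<forall>y\<in>A. \<forall>z\<in>A. b (x + y) z = b x z + b y z \<and> b x (y + z) = b x y + b x z) \<and>
    (\<forall>c. \<forall>x\<in>A. \<forall>y\<in>A. b (s c x) y = t c (b x y) \<and> b x (s c y) = t c (b x y))"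

locale lie_algebra = vector_space smul
  for smul :: "complex \<Rightarrow> 'a::ab_group_add \<Rightarrow> 'a" +
  fixes bracket :: "'a \<Rightarrow> 'a \<Rightarrow> 'a"
  assumes bilinear: "bilinear_on UNIV smul smul bracket"
    and alternating: "bracket x x = 0"
    and jacobi: "bracket x (bracket y z) + bracket y (bracket z x) + bracket z (bracket x y) = 0"

text \<open>The sign $(-1)^{ij}$ for degrees $i, j$ in $\mathbb{Z}_2$, which is the type \<^typ>\<open>bit\<close>.\<close>

definition parity_sign :: "bit \<Rightarrow> bit \<Rightarrow> complex"
  where "parity_sign i j = (if i = 1 \<and> j = 1 then - 1 else 1)"

text \<open>
  A finite-dimensional Lie superalgebra with underlying space \<open>V\<close> and homogeneous parts
  \<open>part 0\<close> (even) and \<open>part 1\<close> (odd).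
\<close>

locale lie_superalgebra = vector_space smul
  for smul :: "complex \<Rightarrow> 'a::ab_group_add \<Rightarrow> 'a" +
  fixes V :: "'a set"
    and part :: "bit \<Rightarrow> 'a set"
    and bracket :: "'a \<Rightarrow> 'a \<Rightarrow> 'a"
  assumes subspace_V: "subspace V"
    and finite_dim: "\<exists>S. finite S \<and> span S = V"
    and subspace_part: "subspace (part i)"
    and part_sum: "V = {x + y | x y. x \<in> part 0 \<and> y \<in> part 1}"
    and part_Int: "part 0 \<inter> part 1 = {0}"
    and bilinear: "bilinear_on V smul smul bracket"
    and graded: "x \<in> part i \<Longrightarrow> y \<in> part j \<Longrightarrow> bracket x y \<in> part (i + j)"
    and super_antisym: "x \<in> part i \<Longrightarrow> y \<in> part j \<Longrightarrow>
      bracket y x = - smul (parity_sign i j) (bracket x y)"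
    and super_jacobi: "x \<in> part i \<Longrightarrow> y \<in> part j \<Longrightarrow> z \<in> part k \<Longrightarrow>
      smul (parity_sign i k) (bracket x (bracket y z))
      + smul (parity_sign j i) (bracket y (bracket z x))
      + smul (parity_sign k j) (bracket z (bracket x y)) = 0"

locale odd_quadratic_lie_superalgebra = lie_superalgebra smul V part bracket
  for smul :: "complex \<Rightarrow> 'a::ab_group_add \<Rightarrow> 'a" and V part bracket +
  fixes B :: "'a \<Rightarrow> 'a \<Rightarrow> complex"
  assumes form_bilinear: "bilinear_on V smul (*) B"
    and nondegenerate_left: "x \<in> V \<Longrightarrow> (\<And>y. y \<in> V \<Longrightarrow> B x y = 0) \<Longrightarrow> x = 0"
    and nondegenerate_right: "y \<in> V \<Longrightarrow> (\<And>x. x \<in> V \<Longrightarrow> B x y = 0) \<Longrightarrow> y = 0"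
    and supersymmetric: "x \<in> part i \<Longrightarrow> y \<in> part j \<Longrightarrow> B y x = parity_sign i j * B x y"
    and invariant: "x \<in> V \<Longrightarrow> y \<in> V \<Longrightarrow> z \<in> V \<Longrightarrow> B (bracket x y) z = B x (bracket y z)"
    and odd_form: "x \<in> part i \<Longrightarrow> y \<in> part i \<Longrightarrow> B x y = 0"

definition dual :: "(complex \<Rightarrow> 'g::ab_group_add \<Rightarrow> 'g) \<Rightarrow> ('g \<Rightarrow> complex) set"
  where "dual smul = {f. Vector_Spaces.linear smul (*) f}"

definition fun_scale :: "complex \<Rightarrow> ('g \<Rightarrow> complex) \<Rightarrow> 'g \<Rightarrow> complex"
  where "fun_scale c f = (\<lambda>X. c * f X)"

text \<open>The adjoint representation is $\mathrm{ad}(X) = [X, -]$, that is, the partial application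
  \<open>bracket X\<close>.\<close>

definition coad :: "('g \<Rightarrow> 'g \<Rightarrow> 'g) \<Rightarrow> 'g \<Rightarrow> ('g \<Rightarrow> complex) \<Rightarrow> 'g \<Rightarrow> complex"
  where "coad bracket X f = - (f \<circ> bracket X)"

text \<open>The element $X + f$ of $\mathfrak{g} \oplus \mathfrak{g}^*$ is the pair \<open>(X, f)\<close>.\<close>

definition ext_scale ::
  "(complex \<Rightarrow> 'g::ab_group_add \<Rightarrow> 'g) \<Rightarrow> complex \<Rightarrow> 'g \<times> ('g \<Rightarrow> complex) \<Rightarrow> 'g \<times> ('g \<Rightarrow> complex)"
  where "ext_scale smul = module_prod.scale smul fun_scale"

definition ext_space :: "(complex \<Rightarrow> 'g::ab_group_add \<Rightarrow> 'g) \<Rightarrow> ('g \<times> ('g \<Rightarrow> complex)) set"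
  where "ext_space smul = UNIV \<times> dual smul"

definition ext_part :: "(complex \<Rightarrow> 'g::ab_group_add \<Rightarrow> 'g) \<Rightarrow> bit \<Rightarrow> ('g \<times> ('g \<Rightarrow> complex)) set"
  where "ext_part smul i = (if i = 0 then UNIV \<times> {0} else {0} \<times> dual smul)"

definition ext_bracket ::
  "('g::ab_group_add \<Rightarrow> 'g \<Rightarrow> 'g) \<Rightarrow> (('g \<Rightarrow> complex) \<Rightarrow> ('g \<Rightarrow> complex) \<Rightarrow> 'g)
    \<Rightarrow> 'g \<times> ('g \<Rightarrow> complex) \<Rightarrow> 'g \<times> ('g \<Rightarrow> complex) \<Rightarrow> 'g \<times> ('g \<Rightarrow> complex)"
  where "ext_bracket bracket \<phi> = (\<lambda>(X, f) (Y, g).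
    (bracket X Y + \<phi> f g, coad bracket X g - coad bracket Y f))"

definition ext_form :: "'g \<times> ('g \<Rightarrow> complex) \<Rightarrow> 'g \<times> ('g \<Rightarrow> complex) \<Rightarrow> complex"
  where "ext_form = (\<lambda>(X, f) (Y, g). f Y + g X)"

end

theory Submission
  imports Defs
begin

text \<open>
  On homogeneous elements the super Jacobi identity depends only on the number of odd arguments.
  With none it is the Jacobi identity of \<open>\<gg>\<close>; with one it says that the coadjoint action is a
  representation; with two it is condition (1); with three it is condition (2). Likewise the
  invariance of the form holds automatically except on three odd arguments, where it is the cyclic
  condition.
\<close>

section \<open>Pointwise vector space structure on functionals\<close>

lemma sum_fun_apply: "(\<Sum>i\<in>A. f i) x = (\<Sum>i\<in>A. f i x)"
  by (induction A rule: infinite_finite_induct) auto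

lemma vector_space_fun_scale: "vector_space fun_scale"
  by unfold_locales (auto simp: fun_scale_def fun_eq_iff algebra_simps)

lemma vector_space_complex_mult: "vector_space ((*) :: complex \<Rightarrow> complex \<Rightarrow> complex)"
  by unfold_locales (auto simp: algebra_simps)

section \<open>Lie algebra identities\<close>

context lie_algebra
begin

lemma bracket_add_left: "bracket (x + y) z = bracket x z + bracket y z"
  and bracket_add_right: "bracket x (y + z) = bracket x y + bracket x z"
  and bracket_scale_left: "bracket (smul c x) y = smul c (bracket x y)"
  and bracket_scale_right: "bracket x (smul c y) = smul c (bracket x y)"
  using bilinear unfolding bilinear_on_def by blast+

lemma bracket_zero_left [simp]: "bracket 0 x = 0"
  and bracket_zero_right [simp]: "bracket x 0 = 0"
  using bracket_scale_left[of 0 0 x] bracket_scale_right[of x 0 0] by simp_all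

lemma bracket_minus_right: "bracket x (- y) = - bracket x y"
  using bracket_add_right[of x y "- y"] by (simp add: eq_neg_iff_add_eq_0 add.commute)

text \<open>Polarization: expand \<open>bracket (x + y) (x + y) = 0\<close>, where the two diagonal
  terms vanish as well.\<close>

lemma bracket_antisym: "bracket y x = - bracket x y"
proof -
  have "bracket (x + y) (x + y) = bracket y x + bracket x y"
    by (simp add: bracket_add_left bracket_add_right alternating[of x] alternating[of y] add.commute)
  then show ?thesis
    by (simp add: alternating eq_neg_iff_add_eq_0)
qed

text \<open>The Jacobi identity in the form ad([x,y]) = [ad(x), ad(y)], oriented as a rewrite rule
  that moves nested brackets to the right. It is what makes the coadjoint action a
  representation.\<close>

lemma bracket_bracket_left:
  "bracket (bracket x y) z = bracket x (bracket y z) - bracket y (bracket x z)"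
proof -
  have "bracket z (bracket x y) = - bracket (bracket x y) z" "bracket z x = - bracket x z"
    by (rule bracket_antisym)+
  then show ?thesis
    using jacobi[of x y z] by (simp add: bracket_minus_right algebra_simps)
qed

section \<open>The dual space and its closure properties\<close>

lemma mem_dual_iff:
  "f \<in> dual smul \<longleftrightarrow> (\<forall>x y. f (x + y) = f x + f y) \<and> (\<forall>c x. f (smul c x) = c * f x)"
  using vector_space_axioms vector_space_complex_mult by (simp add: dual_def Vector_Spaces.linear_iff)

lemma dual_add: "f \<in> dual smul \<Longrightarrow> f (x + y) = f x + f y"
  and dual_scale: "f \<in> dual smul \<Longrightarrow> f (smul c x) = c * f x"
  by (auto simp: mem_dual_iff)

lemma dual_zero: "f \<in> dual smul \<Longrightarrow> f 0 = 0"
  using dual_scale[of f 0 0] by simp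

lemma dual_minus: "f \<in> dual smul \<Longrightarrow> f (- x) = - f x"
  using dual_add[of f x "- x"] dual_zero[of f] by (simp add: eq_neg_iff_add_eq_0 add.commute)

lemma dual_diff: "f \<in> dual smul \<Longrightarrow> f (x - y) = f x - f y"
  using dual_add[of f x "- y"] dual_minus[of f y] by simp

lemma zero_in_dual [simp]: "0 \<in> dual smul"
  by (simp add: mem_dual_iff)

lemma add_in_dual: "f \<in> dual smul \<Longrightarrow> g \<in> dual smul \<Longrightarrow> f + g \<in> dual smul"
  by (simp add: mem_dual_iff algebra_simps)

lemma fun_scale_in_dual: "f \<in> dual smul \<Longrightarrow> fun_scale c f \<in> dual smul"
  by (simp add: mem_dual_iff fun_scale_def algebra_simps)

lemma diff_in_dual: "f \<in> dual smul \<Longrightarrow> g \<in> dual smul \<Longrightarrow> f - g \<in> dual smul"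
  by (simp add: mem_dual_iff algebra_simps)

lemma comp_bracket_in_dual: "f \<in> dual smul \<Longrightarrow> f \<circ> bracket x \<in> dual smul"
  by (simp add: mem_dual_iff bracket_add_right bracket_scale_right)

lemma coad_in_dual: "f \<in> dual smul \<Longrightarrow> coad bracket x f \<in> dual smul"
  by (simp add: mem_dual_iff coad_def bracket_add_right bracket_scale_right)

lemma minus_in_dual: "f \<in> dual smul \<Longrightarrow> - f \<in> dual smul"
  using diff_in_dual[of 0 f] by simp

section \<open>The coadjoint action\<close>

lemma coad_minus_right: "coad bracket x (- f) = - coad bracket x f"
  by (simp add: coad_def fun_eq_iff)

lemma coad_zero_left: "f \<in> dual smul \<Longrightarrow> coad bracket 0 f = 0"
  by (simp add: coad_def fun_eq_iff dual_zero)

lemma coad_zero_right: "coad bracket x 0 = 0"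
  by (simp add: coad_def fun_eq_iff)

text \<open>Precomposition with ad reverses the order of composition, so the commutator changes
  sign; the minus sign in \<open>coad\<close> undoes this. Linearity of \<open>f\<close> carries the
  difference from \<open>bracket_bracket_left\<close> through \<open>f\<close>.\<close>

lemma coad_bracket:
  "f \<in> dual smul \<Longrightarrow>
    coad bracket (bracket x y) f =
      coad bracket x (coad bracket y f) - coad bracket y (coad bracket x f)"
  by (simp add: coad_def fun_eq_iff bracket_bracket_left dual_diff)

section \<open>The ambient vector space of pairs and its graded subspaces\<close>

lemma module_prod_ext: "module_prod smul fun_scale"
  and vector_space_ext: "vector_space (ext_scale smul)"
proof -
  interpret vector_space_prod smul fun_scale
    using vector_space_axioms vector_space_fun_scale
    by (simp add: vector_space_prod_def vector_space_pair_def)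
  show "module_prod smul fun_scale" by unfold_locales
  show "vector_space (ext_scale smul)"
    unfolding ext_scale_def by unfold_locales
qed

lemma ext_scale_Pair [simp]: "ext_scale smul c (x, f) = (smul c x, fun_scale c f)"
  unfolding ext_scale_def by (rule module_prod.scale_prod[OF module_prod_ext])

lemma ext_subspace_iff:
  "module.subspace (ext_scale smul) S \<longleftrightarrow>
    0 \<in> S \<and> (\<forall>u\<in>S. \<forall>v\<in>S. u + v \<in> S) \<and> (\<forall>c. \<forall>u\<in>S. ext_scale smul c u \<in> S)"
proof -
  interpret ext: vector_space "ext_scale smul" by (rule vector_space_ext)
  show ?thesis unfolding ext.subspace_def by auto
qed

lemma subspace_ext_space: "module.subspace (ext_scale smul) (ext_space smul)"
  by (auto simp: ext_subspace_iff ext_space_def zero_prod_def add_in_dual fun_scale_in_dual)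

lemma subspace_ext_part: "module.subspace (ext_scale smul) (ext_part smul i)"
  by (auto simp: ext_subspace_iff ext_part_def zero_prod_def add_in_dual fun_scale_in_dual)
    (auto simp: fun_scale_def fun_eq_iff)

end

section \<open>Extension data, dual basis and finite dimension\<close>

locale odd_extension = finite_dimensional_vector_space smul Basis + lie_algebra smul bracket
  for smul :: "complex \<Rightarrow> 'g::ab_group_add \<Rightarrow> 'g"
    and Basis :: "'g set"
    and bracket :: "'g \<Rightarrow> 'g \<Rightarrow> 'g" +
  fixes \<phi> :: "('g \<Rightarrow> complex) \<Rightarrow> ('g \<Rightarrow> complex) \<Rightarrow> 'g"
  assumes \<phi>_bilinear: "bilinear_on (dual smul) fun_scale smul \<phi>"
    and \<phi>_sym: "f \<in> dual smul \<Longrightarrow> g \<in> dual smul \<Longrightarrow> \<phi> f g = \<phi> g f"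
    and \<phi>_equivariant: "f \<in> dual smul \<Longrightarrow> g \<in> dual smul \<Longrightarrow>
      bracket X (\<phi> f g) + \<phi> f (g \<circ> bracket X) + \<phi> g (f \<circ> bracket X) = 0"
    and \<phi>_cyclic_action: "f \<in> dual smul \<Longrightarrow> g \<in> dual smul \<Longrightarrow> h \<in> dual smul \<Longrightarrow>
      (f \<circ> bracket (\<phi> g h)) + (g \<circ> bracket (\<phi> h f)) + (h \<circ> bracket (\<phi> f g)) = 0"
begin

lemma representation_in_dual: "(\<lambda>v. representation Basis v b) \<in> dual smul"
  unfolding dual_def using linear_representation[OF independent_Basis span_Basis] by simp

lemma basis_expansion: "(\<Sum>b\<in>Basis. smul (representation Basis v b) b) = v"
  by (rule sum_representation_eq) (auto simp: independent_Basis span_Basis finite_Basis)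

lemma dual_sum: "f \<in> dual smul \<Longrightarrow> f (\<Sum>i\<in>A. v i) = (\<Sum>i\<in>A. f (v i))"
  by (induction A rule: infinite_finite_induct) (auto simp: dual_zero dual_add)

text \<open>The coordinate functionals form the dual basis: apply \<open>f\<close> to the basis
  expansion of an arbitrary vector. Hence they span the dual, which gives the odd half of a finite
  spanning set below.\<close>

lemma dual_basis_expansion:
  assumes "f \<in> dual smul"
  shows "(\<Sum>b\<in>Basis. fun_scale (f b) (\<lambda>v. representation Basis v b)) = f"
proof
  fix v
  have "f v = f (\<Sum>b\<in>Basis. smul (representation Basis v b) b)"
    by (simp add: basis_expansion)
  also have "\<dots> = (\<Sum>b\<in>Basis. representation Basis v b * f b)"
    using assms by (simp add: dual_sum dual_scale)
  finally show "(\<Sum>b\<in>Basis. fun_scale (f b) (\<lambda>v. representation Basis v b)) v = f v"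
    by (simp add: sum_fun_apply fun_scale_def mult.commute)
qed

text \<open>The coordinate functionals lie in the dual, so all coordinates of \<open>v\<close>
  vanish. Nondegeneracy of the form on the even part rests on this.\<close>

lemma dual_separates:
  assumes "\<And>f. f \<in> dual smul \<Longrightarrow> f v = 0"
  shows "v = 0"
  using basis_expansion[of v] assms[OF representation_in_dual] by simp

lemma finite_dim_ext_space: "\<exists>S. finite S \<and> module.span (ext_scale smul) S = ext_space smul"
proof -
  interpret ext: vector_space "ext_scale smul" by (rule vector_space_ext)
  define \<epsilon> where "\<epsilon> = (\<lambda>b v. representation Basis v b)"
  \<comment> \<open>The basis in even degree together with its dual basis in odd degree.\<close>
  define S where "S = (\<lambda>b. (b, 0)) ` Basis \<union> (\<lambda>b. (0, \<epsilon> b)) ` Basis"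
  have "ext.span S \<subseteq> ext_space smul"
    by (rule ext.span_minimal[OF _ subspace_ext_space])
      (auto simp: S_def \<epsilon>_def ext_space_def representation_in_dual)
  moreover have "(x, f) \<in> ext.span S" if "f \<in> dual smul" for x f
  proof -
    have "(x, f) = (\<Sum>b\<in>Basis. ext_scale smul (representation Basis x b) (b, 0))
        + (\<Sum>b\<in>Basis. ext_scale smul (f b) (0, \<epsilon> b))"
      using basis_expansion[of x] dual_basis_expansion[OF that]
      by (intro prod_eqI) (simp_all add: fst_sum snd_sum \<epsilon>_def fun_scale_def fun_eq_iff sum_fun_apply)
    also have "\<dots> \<in> ext.span S"
      by (intro ext.span_add ext.span_sum ext.span_scale ext.span_base) (auto simp: S_def)
    finally show ?thesis .
  qed
  ultimately have "ext.span S = ext_space smul"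
    by (auto simp: ext_space_def)
  moreover have "finite S"
    by (simp add: S_def finite_Basis)
  ultimately show ?thesis by blast
qed

section \<open>The map \<phi> and the bracket on homogeneous elements\<close>

lemma \<phi>_add_left:
    "f \<in> dual smul \<Longrightarrow> g \<in> dual smul \<Longrightarrow> h \<in> dual smul \<Longrightarrow>
      \<phi> (f + g) h = \<phi> f h + \<phi> g h"
  and \<phi>_add_right:
    "f \<in> dual smul \<Longrightarrow> g \<in> dual smul \<Longrightarrow> h \<in> dual smul \<Longrightarrow>
      \<phi> f (g + h) = \<phi> f g + \<phi> f h"
  and \<phi>_scale_left:
    "f \<in> dual smul \<Longrightarrow> g \<in> dual smul \<Longrightarrow>
      \<phi> (fun_scale c f) g = smul c (\<phi> f g)"
  and \<phi>_scale_right: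
    "f \<in> dual smul \<Longrightarrow> g \<in> dual smul \<Longrightarrow>
      \<phi> f (fun_scale c g) = smul c (\<phi> f g)"
  using \<phi>_bilinear unfolding bilinear_on_def by blast+

lemma \<phi>_zero_left: "f \<in> dual smul \<Longrightarrow> \<phi> 0 f = 0"
  and \<phi>_zero_right: "f \<in> dual smul \<Longrightarrow> \<phi> f 0 = 0"
  using \<phi>_add_left[of 0 0 f] \<phi>_add_right[of f 0 0] by simp_all

lemma \<phi>_minus_right: "f \<in> dual smul \<Longrightarrow> g \<in> dual smul \<Longrightarrow> \<phi> f (- g) = - \<phi> f g"
  using \<phi>_scale_right[of f g "-1"] by (simp add: fun_scale_def fun_Compl_def)

lemma ext_bracket_even_even: "ext_bracket bracket \<phi> (x, 0) (y, 0) = (bracket x y, 0)"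
  by (simp add: ext_bracket_def coad_zero_right \<phi>_zero_left)

lemma ext_bracket_even_odd:
  "f \<in> dual smul \<Longrightarrow> ext_bracket bracket \<phi> (x, 0) (0, f) = (0, coad bracket x f)"
  by (simp add: ext_bracket_def coad_zero_right \<phi>_zero_left)

lemma ext_bracket_odd_even:
  "f \<in> dual smul \<Longrightarrow> ext_bracket bracket \<phi> (0, f) (x, 0) = (0, - coad bracket x f)"
  by (simp add: ext_bracket_def coad_zero_right \<phi>_zero_right)

lemma ext_bracket_odd_odd:
  "f \<in> dual smul \<Longrightarrow> g \<in> dual smul \<Longrightarrow> ext_bracket bracket \<phi> (0, f) (0, g) = (\<phi> f g, 0)"
  by (simp add: ext_bracket_def coad_zero_left)

text \<open>For each pair of parities exactly one kind of term of the bracket survives, so the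
  graded axioms can be checked by cases on parity.\<close>

lemmas ext_bracket_homogeneous =
  ext_bracket_even_even ext_bracket_even_odd ext_bracket_odd_even ext_bracket_odd_odd

section \<open>The Lie superalgebra axioms\<close>

lemma bilinear_ext_bracket:
  "bilinear_on (ext_space smul) (ext_scale smul) (ext_scale smul) (ext_bracket bracket \<phi>)"
  by (auto simp: bilinear_on_def ext_space_def ext_bracket_def coad_def fun_scale_def[abs_def]
      bracket_add_left bracket_add_right bracket_scale_left bracket_scale_right scale_right_distrib
      \<phi>_add_left \<phi>_add_right \<phi>_scale_left[unfolded fun_scale_def] \<phi>_scale_right[unfolded fun_scale_def]
      dual_add dual_scale algebra_simps fun_eq_iff)

lemma ext_part_cases:
  assumes "u \<in> ext_part smul i"
  obtains (even) x where "i = 0" "u = (x, 0)"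
  | (odd) f where "i = 1" "u = (0, f)" "f \<in> dual smul"
  using assms by (cases i) (auto simp: ext_part_def)

text \<open>The sign in \<open>coad\<close> turns the vanishing sum of condition (1) into a Leibniz
  rule: \<phi> intertwines the action on symmetric pairs of functionals with the adjoint
  action.\<close>

lemma \<phi>_equivariant_coad:
  assumes "f \<in> dual smul" "g \<in> dual smul"
  shows "bracket x (\<phi> f g) = \<phi> f (coad bracket x g) + \<phi> g (coad bracket x f)"
  using \<phi>_equivariant[OF assms, of x] assms comp_bracket_in_dual
  by (simp add: coad_def \<phi>_minus_right algebra_simps eq_neg_iff_add_eq_0)

text \<open>Negating condition (2) turns each composition with ad into a coadjoint action.\<close>

lemma \<phi>_cyclic_coad:
  assumes "f \<in> dual smul" "g \<in> dual smul" "h \<in> dual smul"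
  shows "coad bracket (\<phi> g h) f + coad bracket (\<phi> h f) g + coad bracket (\<phi> f g) h = 0"
  using arg_cong[OF \<phi>_cyclic_action[OF assms], of uminus] by (simp add: coad_def)

text \<open>Two even arguments use antisymmetry of the Lie bracket. For mixed parities the opposite
  signs are built into \<open>ext_bracket\<close>. For two odd arguments the signs cancel and
  symmetry of \<phi> remains.\<close>

lemma super_antisym_ext_bracket:
  assumes "u \<in> ext_part smul i" "v \<in> ext_part smul j"
  shows "ext_bracket bracket \<phi> v u = - ext_scale smul (parity_sign i j) (ext_bracket bracket \<phi> u v)"
  using assms
  by (elim ext_part_cases)
    (auto simp: ext_bracket_homogeneous parity_sign_def fun_scale_def fun_eq_iff \<phi>_sym
      intro: bracket_antisym)

lemma super_jacobi_ext_bracket: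
  assumes "u \<in> ext_part smul i" "v \<in> ext_part smul j" "w \<in> ext_part smul k"
  shows "ext_scale smul (parity_sign i k) (ext_bracket bracket \<phi> u (ext_bracket bracket \<phi> v w))
      + ext_scale smul (parity_sign j i) (ext_bracket bracket \<phi> v (ext_bracket bracket \<phi> w u))
      + ext_scale smul (parity_sign k j) (ext_bracket bracket \<phi> w (ext_bracket bracket \<phi> u v)) = 0"
proof -
  \<comment> \<open>The only values of \<open>parity_sign\<close> are 1 and -1, so these two
    scalings suffice.\<close>
  have scale: "fun_scale 1 f = f" "fun_scale (- 1) f = - f" for f :: "'g \<Rightarrow> complex"
    by (simp_all add: fun_scale_def fun_eq_iff)
  note expand = parity_sign_def scale ext_bracket_homogeneous zero_prod_def coad_in_dual
    minus_in_dual coad_minus_right \<phi>_minus_right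
  show ?thesis
    using assms(1)
  proof (cases rule: ext_part_cases)
    case u: (even x)
    show ?thesis
      using assms(2)
    proof (cases rule: ext_part_cases)
      case v: (even y)
      show ?thesis
        using assms(3)
      proof (cases rule: ext_part_cases)
        case w: (even z)
        show ?thesis
          using jacobi[of x y z] u v w by (simp add: expand)
      next
        case w: (odd h)
        \<comment> \<open>With one odd argument, \<open>coad_bracket\<close> is applied to that
          argument and to the two even ones in the cyclic order in which they follow it; the same
          pattern serves the other two positions.\<close>
        then show ?thesis
          using u v coad_bracket[of h x y]
          by (simp add: expand)
      qed
    next
      case v: (odd g)
      show ?thesis
        using assms(3)
      proof (cases rule: ext_part_cases)
        case w: (even z)
        then show ?thesis
          using u v coad_bracket[of g z x]
          by (simp add: expand)
      next
        case w: (odd h)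
        \<comment> \<open>With two odd arguments, the even one acts on \<phi> of the odd ones, taken
          in the cyclic order in which they follow it. The sign -1 falls on the term whose outer and
          innermost last arguments are both odd, so both \<phi> terms end up negative and cancel the
          Leibniz rule.\<close>
        then show ?thesis
          using u v \<phi>_equivariant_coad[of g h x]
          by (simp add: expand)
      qed
    qed
  next
    case u: (odd f)
    show ?thesis
      using assms(2)
    proof (cases rule: ext_part_cases)
      case v: (even y)
      show ?thesis
        using assms(3)
      proof (cases rule: ext_part_cases)
        case w: (even z)
        then show ?thesis
          using u v coad_bracket[of f y z]
          by (simp add: expand)
      next
        case w: (odd h)
        then show ?thesis
          using u v \<phi>_equivariant_coad[of h f y]
          by (simp add: expand)
      qed
    next
      case v: (odd g)
      show ?thesis
        using assms(3)
      proof (cases rule: ext_part_cases)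
        case w: (even z)
        then show ?thesis
          using u v \<phi>_equivariant_coad[of f g z]
          by (simp add: expand)
      next
        case w: (odd h)
        \<comment> \<open>All three parity signs are -1, and each outer bracket is odd with even,
          hence contributes another minus; the coadjoint terms therefore appear with sign
          plus.\<close>
        then show ?thesis
          using u v \<phi>_cyclic_coad[of f g h]
          by (simp add: expand)
      qed
    qed
  qed
qed

lemma lie_superalgebra_ext:
  "lie_superalgebra (ext_scale smul) (ext_space smul) (ext_part smul) (ext_bracket bracket \<phi>)"
proof (intro lie_superalgebra.intro lie_superalgebra_axioms.intro)
  show "ext_space smul = {u + v | u v. u \<in> ext_part smul 0 \<and> v \<in> ext_part smul 1}"
    by (force simp: ext_space_def ext_part_def)
  show "ext_part smul 0 \<inter> ext_part smul 1 = {0}"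
    by (auto simp: ext_part_def zero_prod_def)
  \<comment> \<open>In \<open>bit\<close>, 1 + 1 = 0, which matches the even value \<phi> takes on
    two odd elements.\<close>
  show "ext_bracket bracket \<phi> u v \<in> ext_part smul (i + j)"
    if "u \<in> ext_part smul i" "v \<in> ext_part smul j" for u v i j
    using that
    by (elim ext_part_cases)
      (auto simp: ext_bracket_homogeneous ext_part_def coad_in_dual minus_in_dual)
qed (fact vector_space_ext subspace_ext_space finite_dim_ext_space subspace_ext_part
    bilinear_ext_bracket super_antisym_ext_bracket super_jacobi_ext_bracket)+

section \<open>The odd invariant form\<close>

lemma invariant_ext_form:
  assumes cyclic: "\<And>f g h. f \<in> dual smul \<Longrightarrow> g \<in> dual smul \<Longrightarrow> h \<in> dual smul \<Longrightarrow>
      h (\<phi> f g) = f (\<phi> g h)"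
    and mem: "u \<in> ext_space smul" "v \<in> ext_space smul" "w \<in> ext_space smul"
  shows "ext_form (ext_bracket bracket \<phi> u v) w = ext_form u (ext_bracket bracket \<phi> v w)"
proof -
  obtain x f y g z h where
    [simp]: "u = (x, f)" "v = (y, g)" "w = (z, h)" and
    dual: "f \<in> dual smul" "g \<in> dual smul" "h \<in> dual smul"
    using mem by (auto simp: ext_space_def)
  \<comment> \<open>Expanding both sides, the term \<open>f (bracket y z)\<close> agrees literally.
    The terms in \<open>g\<close> and \<open>h\<close> differ by swapped bracket arguments, repaired
    here, and the two \<phi> terms agree by the cyclic condition.\<close>
  have "h (bracket y x) = - h (bracket x y)" "g (bracket z x) = - g (bracket x z)"
    using dual by (metis bracket_antisym dual_minus)+
  then show ?thesis
    using dual cyclic[of f g h] by (simp add: ext_form_def ext_bracket_def coad_def dual_add)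
qed

lemma odd_quadratic_lie_superalgebra_ext:
  assumes cyclic: "\<And>f g h. f \<in> dual smul \<Longrightarrow> g \<in> dual smul \<Longrightarrow> h \<in> dual smul \<Longrightarrow>
      h (\<phi> f g) = f (\<phi> g h)"
  shows "odd_quadratic_lie_superalgebra (ext_scale smul) (ext_space smul) (ext_part smul)
    (ext_bracket bracket \<phi>) ext_form"
proof (intro odd_quadratic_lie_superalgebra.intro odd_quadratic_lie_superalgebra_axioms.intro)
  \<comment> \<open>The form is symmetric in the ordinary sense. This is compatible with
    supersymmetry because the sign -1 occurs only for two odd arguments, where the form
    vanishes.\<close>
  have sym: "ext_form u v = ext_form v u" for u v :: "'g \<times> ('g \<Rightarrow> complex)"
    by (cases u; cases v; simp add: ext_form_def add.commute)
  show nondegenerate: "u = 0"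
    if mem: "u \<in> ext_space smul"
      and orthogonal: "\<And>v. v \<in> ext_space smul \<Longrightarrow> ext_form u v = 0" for u
  proof -
    obtain x f where u: "u = (x, f)" "f \<in> dual smul"
      using mem by (auto simp: ext_space_def)
    have form: "f y + g x = 0" if "g \<in> dual smul" for y g
      using orthogonal[of "(y, g)"] that
      by (simp add: u ext_space_def ext_form_def)
    \<comment> \<open>Pairing with the odd elements \<open>(0, g)\<close> shows that every
      functional kills \<open>x\<close>.\<close>
    have "x = 0"
      using form[of _ 0] dual_zero[OF u(2)] by (intro dual_separates) simp
    \<comment> \<open>Pairing with the even elements \<open>(y, 0)\<close> evaluates
      \<open>f\<close> at every \<open>y\<close>.\<close>
    moreover have "f = 0"
      using form[of 0] by (simp add: fun_eq_iff)
    ultimately show ?thesis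
      by (simp add: u zero_prod_def)
  qed
  show "v = 0" if "v \<in> ext_space smul" "\<And>u. u \<in> ext_space smul \<Longrightarrow> ext_form u v = 0" for v
    using nondegenerate[OF that(1)] that(2) sym by metis
  show "bilinear_on (ext_space smul) (ext_scale smul) (*) ext_form"
    by (auto simp: bilinear_on_def ext_space_def ext_form_def fun_scale_def dual_add dual_scale
        algebra_simps)
  show "ext_form v u = parity_sign i j * ext_form u v"
    if "u \<in> ext_part smul i" "v \<in> ext_part smul j" for u v i j
    using that by (elim ext_part_cases) (auto simp: ext_form_def parity_sign_def dual_zero)
  show "ext_form u v = 0" if "u \<in> ext_part smul i" "v \<in> ext_part smul i" for u v i
    using that by (elim ext_part_cases) (auto simp: ext_form_def dual_zero)
  show "ext_form (ext_bracket bracket \<phi> u v) w = ext_form u (ext_bracket bracket \<phi> v w)"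
    if "u \<in> ext_space smul" "v \<in> ext_space smul" "w \<in> ext_space smul" for u v w
    using cyclic that by (rule invariant_ext_form)
qed (fact lie_superalgebra_ext)

end

theorem proposition4p2:
  fixes smul :: "complex \<Rightarrow> 'g::ab_group_add \<Rightarrow> 'g"
    and Basis :: "'g set"
    and bracket :: "'g \<Rightarrow> 'g \<Rightarrow> 'g"
    and \<phi> :: "('g \<Rightarrow> complex) \<Rightarrow> ('g \<Rightarrow> complex) \<Rightarrow> 'g"
  assumes "finite_dimensional_vector_space smul Basis"
    and "lie_algebra smul bracket"
    and "bilinear_on (dual smul) fun_scale smul \<phi>"
    and "\<And>f g. f \<in> dual smul \<Longrightarrow> g \<in> dual smul \<Longrightarrow> \<phi> f g = \<phi> g f"
    and "\<And>X f g. f \<in> dual smul \<Longrightarrow> g \<in> dual smul \<Longrightarrow>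
      bracket X (\<phi> f g) + \<phi> f (g \<circ> bracket X) + \<phi> g (f \<circ> bracket X) = 0"
    and "\<And>f g h. f \<in> dual smul \<Longrightarrow> g \<in> dual smul \<Longrightarrow> h \<in> dual smul \<Longrightarrow>
      (f \<circ> bracket (\<phi> g h)) + (g \<circ> bracket (\<phi> h f)) + (h \<circ> bracket (\<phi> f g)) = 0"
  shows "lie_superalgebra (ext_scale smul) (ext_space smul) (ext_part smul)
      (ext_bracket bracket \<phi>) \<and>
    ((\<forall>f\<in>dual smul. \<forall>g\<in>dual smul. \<forall>h\<in>dual smul. h (\<phi> f g) = f (\<phi> g h)) \<longrightarrow>
      odd_quadratic_lie_superalgebra (ext_scale smul) (ext_space smul) (ext_part smul)
        (ext_bracket bracket \<phi>) ext_form)"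
proof -
  interpret odd_extension smul Basis bracket \<phi>
    using assms by (intro odd_extension.intro odd_extension_axioms.intro)
  show ?thesis
    using lie_superalgebra_ext odd_quadratic_lie_superalgebra_ext by blast
qed

end
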